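(* Let $n\ge 1$ and let $A=(A_1,\ldots,A_n)$ and $B=(B_1,\ldots,B_n)$ be permutations of $\{1,\ldots,n\}$ such that $\mathrm{SUS}(A)\le 3$ and $\mathrm{SUS}(B)\le 3$. If $\mathcal{M}(A)=\mathcal{M}(B)$, then $A=B$.
   Context: For a sequence $P=(P_1,\ldots,P_n)$ of positive integers (packet IDs), define for each time $i\in\{1,\ldots,n\}$: $H_i=\max\{P_1,\ldots,P_i\}$ (the highest ID seen so far), and $L_i$ = the largest integer $k\ge 0$ such that $\{1,2,\ldots,k\}\subseteq\{P_1,\ldots,P_i\}$ (the highest ID that can be delivered in order so far). The buffer sequence of $P$ is $\mathcal{M}(P)=(\mathcal{M}_1,\ldots,\mathcal{M}_n)$ with $\mathcal{M}_i=H_i-L_i$. For example, $\mathcal{M}((4,3,2,1))=(4,4,4,0)$. For a sequence of integers $A$, $\mathrm{SUS}(A)$ (shuffled up-sequences) denotes the minimum number of ascending subsequences into which the sequence $A$ can be partitioned. *)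

theory Defs
  imports Main "HOL-Library.Disjoint_Sets" "HOL-Combinatorics.Multiset_Permutations"
begin

text \<open>Packet IDs are positive integers, modelled as \<^typ>\<open>nat\<close>; times are 1-based, so
  \<open>take i P\<close> consists of the packets that have arrived up to time \<open>i\<close>.\<close>

definition highest_seen :: "nat list \<Rightarrow> nat \<Rightarrow> nat" where
  "highest_seen P i = Max (set (take i P))"

definition highest_deliverable :: "nat list \<Rightarrow> nat \<Rightarrow> nat" where
  "highest_deliverable P i = (GREATEST k. {1..k} \<subseteq> set (take i P))"

definition buffer_seq :: "nat list \<Rightarrow> int list" where
  "buffer_seq P =
     map (\<lambda>i. int (highest_seen P i) - int (highest_deliverable P i)) [1..<length P + 1]"

text \<open>A partition of a sequence into subsequences is a partition of its set of positions
  (0-based here, to match \<^const>\<open>nths\<close>).  Ascending is read weakly, which is the same as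
  strictly for sequences without repetitions.\<close>

definition SUS :: "'a::linorder list \<Rightarrow> nat" where
  "SUS A = (LEAST k. \<exists>Q. partition_on {..<length A} Q \<and> card Q = k \<and>
                         (\<forall>I\<in>Q. sorted (nths A I)))"

end

theory Submission
  imports Defs
begin

text \<open>The buffer sequence determines both the highest ID seen and the highest deliverable ID at
  every time, since at most one of them changes while the buffer is nonempty.  Hence it determines
  every packet except the \<^emph>\<open>silent\<close> ones, which change neither quantity.  A silent packet
  arrives after a larger one (the highest seen) and before a smaller one (the next deliverable),
  so two silent packets in descending order would extend to a descending subsequence of length
  four, which three ascending subsequences cannot cover.  The silent packets therefore arrive in
  ascending order, and their values are those not used elsewhere.\<close>

section \<open>Descending subsequences and SUS\<close>

lemma sorted_nths_le:
  assumes "sorted (nths xs I)" "i < j" "j < length xs" "i \<in> I" "j \<in> I"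
  shows "xs ! i \<le> xs ! j"
  using assms
proof (induction xs arbitrary: I i j)
  case Nil
  then show ?case by simp
next
  case (Cons x xs)
  obtain j' where j: "j = Suc j'" using Cons.prems(2) by (cases j) auto
  let ?J = "{m. Suc m \<in> I}"
  have sorted_tl: "sorted (nths xs ?J)"
    using Cons.prems(1) by (auto simp: nths_Cons split: if_splits)
  show ?case
  proof (cases i)
    case 0
    have "xs ! j' \<in> set (nths xs ?J)"
      using Cons.prems j by (auto simp: set_nths)
    then show ?thesis
      using Cons.prems 0 j by (auto simp: nths_Cons)
  next
    case (Suc i')
    then show ?thesis
      using Cons.IH[OF sorted_tl, of i' j'] Cons.prems j by auto
  qed
qed

text \<open>The partition into singletons qualifies, so the \<open>LEAST\<close> in
  \<open>SUS\<close> is attained.\<close>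

lemma SUS_partition:
  "\<exists>Q. partition_on {..<length A} Q \<and> card Q = SUS A \<and> (\<forall>I\<in>Q. sorted (nths A I))"
proof -
  let ?Q = "(\<lambda>i. {i}) ` {..<length A}"
  have "sorted (nths A {i})" for i
  proof -
    have "card {k. k < length A \<and> k \<in> {i}} \<le> card {i}"
      by (intro card_mono) auto
    then have "length (nths A {i}) \<le> 1"
      by (simp add: length_nths)
    then show ?thesis
      by (cases "nths A {i}") auto
  qed
  moreover have "partition_on {..<length A} ?Q"
    by (auto simp: partition_on_def disjoint_def)
  ultimately have "\<exists>k Q. partition_on {..<length A} Q \<and> card Q = k \<and> (\<forall>I\<in>Q. sorted (nths A I))"
    by blast
  then show ?thesis
    unfolding SUS_def by (rule LeastI_ex)
qed

text \<open>Pigeonhole: a sorted block holds at most one position of \<open>K\<close>, so sending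
  each position to its block is injective.\<close>

lemma card_descending_le_SUS:
  assumes "K \<subseteq> {..<length A}"
    and desc: "\<And>i j. i \<in> K \<Longrightarrow> j \<in> K \<Longrightarrow> i < j \<Longrightarrow> A ! j < A ! i"
  shows "card K \<le> SUS A"
proof -
  obtain Q where Q: "partition_on {..<length A} Q" "card Q = SUS A"
    and sorted: "\<forall>I\<in>Q. sorted (nths A I)"
    using SUS_partition by blast
  have "\<forall>i\<in>K. \<exists>I. I \<in> Q \<and> i \<in> I"
    using assms(1) partition_onD1[OF Q(1)] by blast
  then obtain f where f: "\<And>i. i \<in> K \<Longrightarrow> f i \<in> Q \<and> i \<in> f i"
    by metis
  have "f i \<noteq> f j" if ij: "i \<in> K" "j \<in> K" "i < j" for i j
  proof
    assume "f i = f j"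
    then have "A ! i \<le> A ! j"
      using sorted_nths_le[of A "f i" i j] ij f[of i] f[of j] sorted assms(1) by auto
    then show False
      using desc[OF ij] by simp
  qed
  then have "inj_on f K"
    by (intro inj_onI) (metis linorder_neqE_nat)
  moreover have "finite Q"
    using Q(1) finite_elements by blast
  ultimately show ?thesis
    using card_inj_on_le[of f K Q] f Q(2) by auto
qed

section \<open>Highest seen and highest deliverable ID of a set of arrived packets\<close>

text \<open>Inserting 0 fixes the value before the first arrival, where \<open>Max\<close> would be
  applied to the empty set.\<close>

definition hi :: "nat set \<Rightarrow> nat" where
  "hi S = Max (insert 0 S)"

definition lo :: "nat set \<Rightarrow> nat" where
  "lo S = (GREATEST k. {1..k} \<subseteq> S)"

lemma hi_ge: "finite S \<Longrightarrow> x \<in> S \<Longrightarrow> x \<le> hi S"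
  by (simp add: hi_def)

lemma hi_in: "finite S \<Longrightarrow> 0 < hi S \<Longrightarrow> hi S \<in> S"
  using Max_in[of "insert 0 S"] by (auto simp: hi_def)

lemma hi_insert: "finite S \<Longrightarrow> hi (insert p S) = max p (hi S)"
  by (cases "S = {}") (simp_all add: hi_def insert_commute[of 0 p])

text \<open>Bounds the candidates in \<open>lo\<close>, so that its \<open>GREATEST\<close> exists
  for finite \<open>S\<close>.\<close>

lemma initial_segment_le_card: "finite S \<Longrightarrow> {1..k} \<subseteq> S \<Longrightarrow> k \<le> card S"
  using card_mono[of S "{1..k}"] by simp

lemma lo_subset: "finite S \<Longrightarrow> {1..lo S} \<subseteq> S"
  unfolding lo_def
  by (rule GreatestI_nat[where k = 0 and b = "card S"]) (use initial_segment_le_card in auto)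

lemma le_lo: "finite S \<Longrightarrow> {1..k} \<subseteq> S \<Longrightarrow> k \<le> lo S"
  unfolding lo_def
  by (rule Greatest_le_nat[where b = "card S"]) (use initial_segment_le_card in auto)

lemma Suc_lo_notin:
  assumes "finite S"
  shows "Suc (lo S) \<notin> S"
proof
  assume "Suc (lo S) \<in> S"
  then have "{1..Suc (lo S)} \<subseteq> S"
    using lo_subset[OF assms] by (auto simp: le_Suc_eq)
  then show False
    using le_lo[OF assms] by fastforce
qed

lemma lo_eqI:
  assumes "finite S" "{1..k} \<subseteq> S" "Suc k \<notin> S"
  shows "lo S = k"
proof (rule antisym)
  show "lo S \<le> k"
  proof (rule ccontr)
    assume "\<not> lo S \<le> k"
    then have "Suc k \<in> {1..lo S}" by simp
    then show False
      using lo_subset[OF assms(1)] assms(3) by blast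
  qed
qed (rule le_lo[OF assms(1,2)])

lemma lo_le_hi: "finite S \<Longrightarrow> lo S \<le> hi S"
  using lo_subset[of S] hi_ge[of S "lo S"] by (cases "lo S") (auto simp: subset_iff)

lemma lo_insert:
  assumes "finite S" "p \<noteq> Suc (lo S)"
  shows "lo (insert p S) = lo S"
  using assms lo_subset[of S] Suc_lo_notin[of S] by (intro lo_eqI) auto

text \<open>Only growth is claimed: filling the gap may release a whole run of waiting packets, so
  the new value can exceed \<open>Suc (lo S)\<close>.\<close>

lemma lo_insert_Suc_lo:
  assumes "finite S"
  shows "lo S < lo (insert (Suc (lo S)) S)"
  using assms lo_subset[of S] le_lo[of "insert (Suc (lo S)) S" "Suc (lo S)"]
  by (auto simp: le_Suc_eq subset_iff Suc_le_eq)

section \<open>Effect of a single arrival\<close>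

text \<open>For finite \<open>S\<close> the subtraction is never truncated, by
  \<open>lo_le_hi\<close>.\<close>

definition buf :: "nat set \<Rightarrow> nat" where
  "buf S = hi S - lo S"

definition silent :: "nat set \<Rightarrow> nat \<Rightarrow> bool" where
  "silent S p \<longleftrightarrow> Suc (lo S) < p \<and> p < hi S"

text \<open>The old and new buffer values alone tell the cases apart: zero before and after, growth,
  decrease, or positive and unchanged. Every case computes the new \<open>hi\<close> and
  \<open>lo\<close> from the old ones and these values; all but \<open>silent\<close> also compute
  \<open>p\<close>.\<close>

lemma arrival_cases:
  assumes "finite S" "p \<notin> S" "0 < p"
  obtains (deliver_empty) "buf S = 0" "p = Suc (hi S)" "buf (insert p S) = 0"
      "hi (insert p S) = p" "lo (insert p S) = p"
  | (new_max) "p = hi S + (buf (insert p S) - buf S)" "buf S < buf (insert p S)"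
      "hi (insert p S) = p" "lo (insert p S) = lo S"
  | (deliver) "0 < buf S" "p = Suc (lo S)" "buf (insert p S) < buf S"
      "hi (insert p S) = hi S" "lo (insert p S) = hi S - buf (insert p S)"
  | (silent) "0 < buf S" "silent S p" "buf (insert p S) = buf S"
      "hi (insert p S) = hi S" "lo (insert p S) = lo S"
proof -
  have le: "lo S \<le> hi S" and le': "lo (insert p S) \<le> hi (insert p S)"
    using assms(1) by (simp_all add: lo_le_hi)
  have gt_lo: "lo S < p"
    using lo_subset[OF assms(1)] assms(2,3) by (intro not_le_imp_less) (auto simp: subset_iff)
  have hi: "hi (insert p S) = max p (hi S)"
    using assms(1) by (rule hi_insert)
  \<comment> \<open>If \<open>hi S = 0\<close>, this is \<open>0 < p\<close>; otherwise
    \<open>hi S\<close> has already arrived.\<close>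
  have ne_hi: "p \<noteq> hi S"
    using assms hi_in[of S] by auto
  show thesis
  proof (cases "p = Suc (lo S)")
    case True
    have up: "lo S < lo (insert p S)"
      using lo_insert_Suc_lo[OF assms(1)] True by simp
    show thesis
    proof (cases "hi S = lo S")
      \<comment> \<open>Here \<open>p = Suc (hi S)\<close> is also the new maximum, and the new
        \<open>lo\<close> lies above \<open>hi S\<close> but not above \<open>p\<close>.\<close>
      case empty: True
      then show thesis
        using deliver_empty True hi up le' by (auto simp: buf_def)
    next
      case False
      then have "p < hi S"
        using True le ne_hi by simp
      then show thesis
        using deliver True hi up le' le by (auto simp: buf_def)
    qed
  next
    case False
    have lo: "lo (insert p S) = lo S"
      using assms(1) False by (rule lo_insert)
    show thesis
    proof (cases "hi S < p")
      case True
      then show thesis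
        using new_max lo hi le by (auto simp: buf_def)
    next
      case le_hi: False
      then show thesis
        using silent lo hi gt_lo ne_hi False by (auto simp: buf_def silent_def)
    qed
  qed
qed

text \<open>The sets may differ by silent packets, so only \<open>hi\<close> and \<open>lo\<close>
  are compared. The buffer values exclude pairs of different cases, and in equal cases the formulas
  of \<open>arrival_cases\<close> coincide.\<close>

lemma arrival_determined:
  assumes S: "finite S" "p \<notin> S" "0 < p" and T: "finite T" "q \<notin> T" "0 < q"
    and eq: "hi S = hi T" "lo S = lo T"
    and buf: "buf (insert p S) = buf (insert q T)"
  shows "hi (insert p S) = hi (insert q T) \<and> lo (insert p S) = lo (insert q T)
    \<and> (p = q \<or> silent S p \<and> silent T q)"
proof -
  have "buf S = buf T"
    by (simp add: buf_def eq)
  from S show ?thesis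
  proof (cases rule: arrival_cases)
    case deliver_empty
    from T show ?thesis
      by (cases rule: arrival_cases) (use deliver_empty eq buf \<open>buf S = buf T\<close> in auto)
  next
    case new_max
    from T show ?thesis
      by (cases rule: arrival_cases) (use new_max eq buf \<open>buf S = buf T\<close> in auto)
  next
    case deliver
    from T show ?thesis
      by (cases rule: arrival_cases) (use deliver eq buf \<open>buf S = buf T\<close> in auto)
  next
    case silent
    from T show ?thesis
      by (cases rule: arrival_cases) (use silent eq buf \<open>buf S = buf T\<close> in auto)
  qed
qed

section \<open>Silent packets and the state over time\<close>

definition silent_at :: "nat list \<Rightarrow> nat \<Rightarrow> bool" where
  "silent_at P i \<longleftrightarrow> silent (set (take i P)) (P ! i)"

lemma buffer_seq_nth:
  assumes "i < length P"
  shows "buffer_seq P ! i = int (buf (set (take (Suc i) P)))"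
proof -
  let ?S = "set (take (Suc i) P)"
  have "?S \<noteq> {}" using assms(1) by (cases P) auto
  then have "Max ?S = hi ?S"
    by (simp add: hi_def)
  \<comment> \<open>By \<open>lo_le_hi\<close> the natural difference in \<open>buf\<close> equals
    the integer one.\<close>
  then show ?thesis
    using assms lo_le_hi[of ?S]
    by (simp add: buffer_seq_def highest_seen_def highest_deliverable_def buf_def
        lo_def del: upt_Suc)
qed

lemma silent_ascending:
  assumes "A \<in> permutations_of_set {1..n}" "SUS A \<le> 3"
    and "silent_at A i" "silent_at A j" "i < j" "j < n"
  shows "A ! i < A ! j"
proof (rule ccontr)
  have A: "set A = {1..n}" "distinct A" "length A = n"
    using assms(1) length_finite_permutations_of_set[OF assms(1)] by (auto dest: permutations_of_setD)
  assume "\<not> A ! i < A ! j"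
  then have lt: "A ! j < A ! i"
    using A assms(5,6) nth_eq_iff_index_eq[of A i j] by linarith
  let ?S = "set (take i A)" and ?T = "set (take j A)"
  have si: "A ! i < hi ?S" and sj: "Suc (lo ?T) < A ! j"
    using assms(3,4) by (auto simp: silent_at_def silent_def)
  \<comment> \<open>\<open>h\<close> is where the maximum before position \<open>i\<close>
    arrived.\<close>
  obtain h where h: "h < i" "A ! h = hi ?S"
    using hi_in[of ?S] si by (auto simp: in_set_conv_nth)
  have "A ! j \<in> set A"
    using A(3) assms(6) by simp
  \<comment> \<open>The next deliverable ID is below \<open>A ! j\<close>, so it occurs in
    \<open>A\<close>; being missing from \<open>?T\<close>, it arrives after position
    \<open>j\<close>.\<close>
  then have "Suc (lo ?T) \<in> set A"
    using A(1) sj by auto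
  then obtain l where l: "l < n" "A ! l = Suc (lo ?T)"
    using A(3) by (auto simp: in_set_conv_nth)
  have "\<not> l < j"
    using Suc_lo_notin[of ?T] l A(3) by (force simp: in_set_conv_nth)
  moreover have "l \<noteq> j"
    using l sj by auto
  ultimately have "j < l" by simp
  \<comment> \<open>The values at \<open>h\<close>, \<open>i\<close>, \<open>j\<close>,
    \<open>l\<close> descend: old maximum, the two silent packets, next deliverable ID.\<close>
  have "card {h, i, j, l} \<le> SUS A"
    using h l lt si sj \<open>j < l\<close> \<open>i < j\<close> A(3)
    by (intro card_descending_le_SUS) auto
  moreover have "card {h, i, j, l} = 4"
    using h \<open>j < l\<close> \<open>i < j\<close> by auto
  ultimately show False
    using assms(2) by simp
qed

text \<open>Induction over arrivals from the common empty state; equality of \<open>hi\<close> and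
  \<open>lo\<close> is the invariant that \<open>arrival_determined\<close> passes on.\<close>

lemma buffer_seq_determines:
  assumes A: "A \<in> permutations_of_set {1..n}" and B: "B \<in> permutations_of_set {1..n}"
    and eq: "buffer_seq A = buffer_seq B" and "i \<le> n"
  shows "hi (set (take i A)) = hi (set (take i B)) \<and> lo (set (take i A)) = lo (set (take i B))
    \<and> (\<forall>j<i. A ! j = B ! j \<or> silent_at A j \<and> silent_at B j)"
  using \<open>i \<le> n\<close>
proof (induction i)
  case 0
  then show ?case by simp
next
  case (Suc i)
  have len: "length A = n" "length B = n" and pos: "0 \<notin> set A" "0 \<notin> set B"
    and dist: "distinct A" "distinct B"
    using A B A[THEN length_finite_permutations_of_set] B[THEN length_finite_permutations_of_set]
    by (auto dest: permutations_of_setD)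
  have i: "i < length A" "i < length B"
    using Suc.prems len by auto
  have step: "set (take (Suc i) P) = insert (P ! i) (set (take i P))" if "i < length P"
    for P :: "nat list"
    using that by (simp add: take_Suc_conv_app_nth)
  have fresh: "P ! i \<notin> set (take i P)" if "i < length P" "distinct P" for P :: "nat list"
    using that by (auto simp: in_set_conv_nth nth_eq_iff_index_eq)
  have "buf (set (take (Suc i) A)) = buf (set (take (Suc i) B))"
    using buffer_seq_nth[OF i(1)] buffer_seq_nth[OF i(2)] eq by simp
  moreover have "0 < A ! i" "0 < B ! i"
    using i pos by (metis gr0I nth_mem)+
  ultimately show ?case
    using arrival_determined[of "set (take i A)" "A ! i" "set (take i B)" "B ! i"] Suc i dist
    by (auto simp: step fresh silent_at_def less_Suc_eq)
qed

text \<open>The position of \<open>xs ! i\<close> in \<open>ys\<close> cannot precede \<open>i\<close>, so it is a later position of \<open>I\<close>.\<close>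

lemma nth_ge_of_mono_on_differences:
  fixes xs ys :: "'a::linorder list"
  assumes "distinct xs" "set xs = set ys" "length xs = length ys"
    and agree: "\<And>k. k < length ys \<Longrightarrow> k \<notin> I \<Longrightarrow> xs ! k = ys ! k"
    and mono: "\<And>k l. k \<in> I \<Longrightarrow> l \<in> I \<Longrightarrow> k < l \<Longrightarrow> l < length ys \<Longrightarrow> ys ! k < ys ! l"
    and prefix: "\<And>k. k < i \<Longrightarrow> xs ! k = ys ! k" and "i < length ys"
  shows "ys ! i \<le> xs ! i"
proof (cases "i \<in> I")
  case True
  have "xs ! i \<in> set ys"
    using assms(2,3,7) nth_mem by metis
  then obtain j where j: "j < length ys" "ys ! j = xs ! i"
    by (auto simp: in_set_conv_nth)
  have "xs ! j \<noteq> ys ! j" if "j \<noteq> i"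
    using that j assms(1,3,7) by (simp add: nth_eq_iff_index_eq)
  then consider "j = i" | "i < j" "j \<in> I"
    using agree[OF j(1)] prefix[of j] by (cases j i rule: linorder_cases) auto
  then show ?thesis
    using mono[of i j] True j by cases auto
qed (use agree assms(7) in auto)

theorem theorem1:
  fixes n :: nat and A B :: "nat list"
  assumes "n \<ge> 1"
    and "A \<in> permutations_of_set {1..n}"
    and "B \<in> permutations_of_set {1..n}"
    and "SUS A \<le> 3"
    and "SUS B \<le> 3"
    and "buffer_seq A = buffer_seq B"
  shows "A = B"
proof (rule nth_equalityI)
  have A: "set A = {1..n}" "distinct A" "length A = n"
    and B: "set B = {1..n}" "distinct B" "length B = n"
    using assms(2,3) assms(2,3)[THEN length_finite_permutations_of_set]
    by (auto dest: permutations_of_setD)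
  then show "length A = length B" by simp
  \<comment> \<open>Off \<open>?I\<close> the sequences agree; on \<open>?I\<close> both
    ascend.\<close>
  let ?I = "{i. silent_at A i \<and> silent_at B i}"
  have agree: "A ! k = B ! k" if "k < n" "k \<notin> ?I" for k
    using buffer_seq_determines[OF assms(2,3,6) order_refl] that by auto
  have mono: "A ! k < A ! l" "B ! k < B ! l" if "k \<in> ?I" "l \<in> ?I" "k < l" "l < n" for k l
    using that silent_ascending[OF assms(2,4)] silent_ascending[OF assms(3,5)] by auto
  fix i
  assume "i < length A"
  then show "A ! i = B ! i"
  proof (induction i rule: less_induct)
    case (less i)
    \<comment> \<open>The induction hypothesis supplies the common prefix; exchanging
      \<open>A\<close> and \<open>B\<close> gives the reverse inequality.\<close>
    have "B ! i \<le> A ! i"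
      by (rule nth_ge_of_mono_on_differences[where I = ?I]) (use A B less agree mono in auto)
    moreover have "A ! i \<le> B ! i"
      by (rule nth_ge_of_mono_on_differences[where I = ?I])
        (use A B less mono agree[symmetric] in auto)
    ultimately show ?case by simp
  qed
qed

end
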